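(* Let $f:\mathbb{R}^d\to\mathbb{R}$ be $L$-smooth and $\mu$-strongly-convex ($\mu>0$), with minimizer $x^*$. Let $s>0$ and let $m,n,q$ satisfy $$0<m\sqrt s\le\frac{1}{2L},\qquad 0<ns\le m\sqrt s,\qquad 0<q\sqrt s\le\frac12 .$$ Let $(x_k)$ be the position sequence produced by the semi-implicit Euler scheme $$x_{k+1}-x_k=-m\sqrt s\,\nabla f(x_k)-n\sqrt s\,v_k,\qquad v_{k+1}-v_k=\sqrt s\,\nabla f(x_{k+1})-q\sqrt s\,v_k .$$ Then there exists a constant $C>0$ such that for every $k\in\mathbb{N}$ $$f(x_k)-f(x^* )\le(1+\gamma_2\sqrt s)^{-k}\,C,\qquad \gamma_2:=\frac15\min\left(\frac{n\mu}{q},\ \frac{q}{1+q^2/(nL)}\right).$$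
   Context: $\|\cdot\|$ is the Euclidean norm. $f$ is $L$-smooth if it is differentiable and $\|\nabla f(x)-\nabla f(y)\|\le L\|x-y\|$ for all $x,y$; $f$ is $\mu$-strongly-convex if $f(y)\ge f(x)+\langle\nabla f(x),y-x\rangle+\frac\mu2\|y-x\|^2$ for all $x,y$. The scheme is started from arbitrary initial data; $C$ is independent of $k$ (it may depend on the initial data and the parameters). *)

theory Defs
  imports "HOL-Analysis.Analysis"
begin

text \<open>\<open>THE\<close> is meaningful only where \<open>f\<close> is differentiable; see \<open>GDERIV_gradient\<close>.\<close>

definition gradient :: "('a::euclidean_space \<Rightarrow> real) \<Rightarrow> 'a \<Rightarrow> 'a" where
  "gradient f x = (THE D. GDERIV f x :> D)"

lemma GDERIV_unique:
  assumes "GDERIV f x :> D" "GDERIV f x :> E"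
  shows "D = E"
proof -
  have "(\<lambda>h. inner h D) = (\<lambda>h. inner h E)"
    using assms unfolding gderiv_def by (rule has_derivative_unique)
  then have "inner (D - E) D = inner (D - E) E" by (rule fun_cong)
  then have "inner (D - E) (D - E) = 0" by (simp add: inner_diff_right)
  then show ?thesis by simp
qed

lemma GDERIV_gradient:
  fixes f :: "'a::euclidean_space \<Rightarrow> real"
  assumes "f differentiable (at x)"
  shows "GDERIV f x :> gradient f x"
proof -
  obtain f' where f': "(f has_derivative f') (at x)"
    using assms by (auto simp: differentiable_def)
  have lin: "linear f'" by (rule has_derivative_linear[OF f'])
  let ?D = "\<Sum>b\<in>Basis. f' b *\<^sub>R b"
  have "f' h = inner h ?D" for h
  proof -
    have "f' h = f' (\<Sum>b\<in>Basis. inner h b *\<^sub>R b)"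
      by (simp add: euclidean_representation)
    also have "\<dots> = (\<Sum>b\<in>Basis. inner h b * f' b)"
      by (simp add: linear_sum[OF lin] linear_scale[OF lin])
    also have "\<dots> = inner h ?D"
      by (simp add: inner_sum_right mult.commute)
    finally show ?thesis .
  qed
  then have "f' = (\<lambda>h. inner h ?D)" by (rule ext)
  then have D: "GDERIV f x :> ?D"
    using f' by (simp add: gderiv_def)
  show ?thesis
    unfolding gradient_def by (rule theI[where P = "\<lambda>D. GDERIV f x :> D", OF D])
      (rule GDERIV_unique[OF _ D])
qed

definition L_smooth :: "real \<Rightarrow> ('a::euclidean_space \<Rightarrow> real) \<Rightarrow> bool" where
  "L_smooth L f \<longleftrightarrow> (\<forall>x. f differentiable (at x)) \<and>
     (\<forall>x y. norm (gradient f x - gradient f y) \<le> L * norm (x - y))"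

text \<open>This first-order condition is meant for differentiable \<open>f\<close> only;
  differentiability is not part of the definition.\<close>

definition strongly_convex :: "real \<Rightarrow> ('a::euclidean_space \<Rightarrow> real) \<Rightarrow> bool" where
  "strongly_convex \<mu> f \<longleftrightarrow>
     (\<forall>x y. f y \<ge> f x + inner (gradient f x) (y - x) + \<mu> / 2 * (norm (y - x))\<^sup>2)"

text \<open>The gradient step for \<open>v\<close> is evaluated at the already updated position
  \<open>x (Suc k)\<close>. The initial data \<open>x 0\<close> and \<open>v 0\<close> are unconstrained.\<close>

definition semi_implicit_euler ::
  "('a::euclidean_space \<Rightarrow> real) \<Rightarrow> real \<Rightarrow> real \<Rightarrow> real \<Rightarrow> real \<Rightarrow> (nat \<Rightarrow> 'a) \<Rightarrow> (nat \<Rightarrow> 'a) \<Rightarrow> bool" where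
  "semi_implicit_euler f m n q s x v \<longleftrightarrow>
     (\<forall>k. x (Suc k) - x k = - (m * sqrt s) *\<^sub>R gradient f (x k) - (n * sqrt s) *\<^sub>R v k \<and>
          v (Suc k) - v k = sqrt s *\<^sub>R gradient f (x (Suc k)) - (q * sqrt s) *\<^sub>R v k)"

definition gamma2 :: "real \<Rightarrow> real \<Rightarrow> real \<Rightarrow> real \<Rightarrow> real" where
  "gamma2 n q \<mu> L = 1 / 5 * min (n * \<mu> / q) (q / (1 + q\<^sup>2 / (n * L)))"

end

theory Submission
  imports Defs
begin

text \<open>With \<open>\<alpha> = m \<surd>s\<close>, \<open>\<beta> = n s\<close>, \<open>\<theta> = q \<surd>s\<close>, \<open>u = n \<surd>s v\<close> and \<open>g = \<nabla>f(x)\<close> the scheme reads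
  \<open>x' = x - \<alpha> g - u\<close>, \<open>u' = (1 - \<theta>) u + \<beta> g'\<close>. The combination \<open>z = \<theta> (x - x\<^sup>* - \<alpha> g) - u\<close>
  then moves by pure gradient steps, \<open>z' = z - (\<alpha> \<theta> + \<beta>) g'\<close>. Hence
  \<open>A (f(x) - f(x\<^sup>*) - \<alpha>/2 |g|\<^sup>2) + |u|\<^sup>2/2 + |z|\<^sup>2/2\<close> is a Lyapunov function: the choice
  \<open>A = (1 - \<theta>) (\<alpha> \<theta> + 2 \<beta>)\<close> cancels the cross terms \<open>\<langle>g', u\<rangle>\<close>, and cocoercivity of the gradient
  absorbs the squared gradient steps. It contracts by the factor \<open>1 / (1 + r)\<close> as soon as
  \<open>r \<le> \<theta>/5\<close> and \<open>r \<theta> \<le> \<beta> \<mu>/5\<close>.\<close>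

section \<open>Inequalities for smooth and convex functions\<close>

lemma L_smooth_upper_bound:
  fixes f :: "'a::euclidean_space \<Rightarrow> real"
  assumes "L_smooth L f"
  shows "f y \<le> f x + gradient f x \<bullet> (y - x) + L / 2 * (norm (y - x))\<^sup>2"
proof -
  define d where "d = y - x"
  \<comment> \<open>Cauchy-Schwarz and the Lipschitz gradient make the derivative of
    \<open>\<phi>\<close> nonpositive for t >= 0, so comparing t = 1 with t = 0 gives the quadratic
    bound without integration.\<close>
  define \<phi> where "\<phi> t = f (x + t *\<^sub>R d) - t * (gradient f x \<bullet> d) - L / 2 * t\<^sup>2 * (norm d)\<^sup>2" for t
  have lip: "norm (gradient f a - gradient f b) \<le> L * norm (a - b)" for a b
    using assms by (auto simp: L_smooth_def)
  have deriv: "(\<phi> has_real_derivative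
      (gradient f (x + t *\<^sub>R d) \<bullet> d - gradient f x \<bullet> d - L * t * (norm d)\<^sup>2)) (at t)" for t
  proof -
    have "GDERIV f (x + t *\<^sub>R d) :> gradient f (x + t *\<^sub>R d)"
      using assms by (intro GDERIV_gradient) (auto simp: L_smooth_def)
    then have "(f has_derivative (\<lambda>h. h \<bullet> gradient f (x + t *\<^sub>R d))) (at (x + t *\<^sub>R d))"
      by (simp add: gderiv_def)
    moreover have "((\<lambda>t. x + t *\<^sub>R d) has_derivative (\<lambda>h. h *\<^sub>R d)) (at t)"
      by (auto intro!: derivative_eq_intros)
    ultimately have "((\<lambda>t. f (x + t *\<^sub>R d)) has_derivative
        (\<lambda>h. (h *\<^sub>R d) \<bullet> gradient f (x + t *\<^sub>R d))) (at t)"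
      by (rule has_derivative_compose[rotated])
    then have "((\<lambda>t. f (x + t *\<^sub>R d)) has_real_derivative gradient f (x + t *\<^sub>R d) \<bullet> d) (at t)"
      by (simp add: has_field_derivative_def inner_commute mult_commute_abs)
    then show ?thesis
      unfolding \<phi>_def by (auto intro!: derivative_eq_intros)
  qed
  have "\<phi> 1 \<le> \<phi> 0"
  proof (rule DERIV_nonpos_imp_nonincreasing[where f = \<phi>])
    fix t :: real assume t: "0 \<le> t"
    have "gradient f (x + t *\<^sub>R d) \<bullet> d - gradient f x \<bullet> d
        \<le> norm (gradient f (x + t *\<^sub>R d) - gradient f x) * norm d"
      by (metis inner_diff_left norm_cauchy_schwarz)
    also have "\<dots> \<le> L * norm (t *\<^sub>R d) * norm d"
      using lip[of "x + t *\<^sub>R d" x] by (intro mult_right_mono) auto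
    also have "\<dots> = L * t * (norm d)\<^sup>2"
      using t by (simp add: power2_eq_square)
    finally show "\<exists>D. (\<phi> has_real_derivative D) (at t) \<and> D \<le> 0"
      using deriv[of t] by (intro exI conjI) auto
  qed simp
  then show ?thesis
    by (simp add: \<phi>_def d_def)
qed

lemma strongly_convex_imp_first_order:
  assumes "strongly_convex \<mu> f" "0 \<le> \<mu>"
  shows "f x + gradient f x \<bullet> (y - x) \<le> f y"
proof -
  have "f x + gradient f x \<bullet> (y - x) + \<mu> / 2 * (norm (y - x))\<^sup>2 \<le> f y"
    using assms(1) by (auto simp: strongly_convex_def)
  moreover have "0 \<le> \<mu> / 2 * (norm (y - x))\<^sup>2"
    using assms(2) by simp
  ultimately show ?thesis by linarith
qed

text \<open>The point \<open>w\<close> is a descent step of length 1/L from x for f minus its linear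
  part at y. Smoothness at x bounds f(w) from above, convexity at y bounds it from below, and the
  decrease of this step is the squared term.\<close>

lemma smooth_convex_lower_bound:
  fixes f :: "'a::euclidean_space \<Rightarrow> real"
  assumes "L_smooth L f" "0 < L"
    and convex: "\<And>x y. f x + gradient f x \<bullet> (y - x) \<le> f y"
  shows "f y + gradient f y \<bullet> (x - y) + 1 / (2 * L) * (norm (gradient f x - gradient f y))\<^sup>2 \<le> f x"
proof -
  define e where "e = gradient f x - gradient f y"
  define w where "w = x - (1 / L) *\<^sub>R e"
  have "f w \<le> f x + gradient f x \<bullet> (w - x) + L / 2 * (norm (w - x))\<^sup>2"
    by (rule L_smooth_upper_bound[OF assms(1)])
  also have "gradient f x \<bullet> (w - x) = - (1 / L) * (gradient f x \<bullet> e)"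
    by (simp add: w_def)
  also have "L / 2 * (norm (w - x))\<^sup>2 = 1 / (2 * L) * (norm e)\<^sup>2"
    using assms(2) by (simp add: w_def power_divide power2_eq_square)
  finally have up: "f w \<le> f x - (1 / L) * (gradient f x \<bullet> e) + 1 / (2 * L) * (norm e)\<^sup>2" by simp
  have "f y + gradient f y \<bullet> (w - y) \<le> f w" by (rule convex)
  moreover have "gradient f y \<bullet> (w - y) = gradient f y \<bullet> (x - y) - (1 / L) * (gradient f y \<bullet> e)"
    by (simp add: w_def inner_diff_right)
  moreover have "(1 / L) * (gradient f x \<bullet> e) - (1 / L) * (gradient f y \<bullet> e) = (1 / L) * (norm e)\<^sup>2"
    by (simp add: e_def dot_square_norm[symmetric] inner_diff_left right_diff_distrib)
  moreover have "(1 / L) * (norm e)\<^sup>2 = 2 * (1 / (2 * L) * (norm e)\<^sup>2)" by simp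
  ultimately have "f y + gradient f y \<bullet> (x - y) + 1 / (2 * L) * (norm e)\<^sup>2 \<le> f x"
    using up by linarith
  then show ?thesis by (simp add: e_def)
qed

text \<open>A gradient step of length 1/L lowers f by at least |g|^2/(2L), which is impossible at a
  minimizer unless g = 0.\<close>

lemma gradient_arg_min:
  fixes f :: "'a::euclidean_space \<Rightarrow> real"
  assumes "L_smooth L f" "0 < L" "is_arg_min f (\<lambda>_. True) xstar"
  shows "gradient f xstar = 0"
proof -
  define g where "g = gradient f xstar"
  have "f xstar \<le> f (xstar - (1 / L) *\<^sub>R g)"
    using assms(3) by (simp add: is_arg_min_linorder)
  also have "\<dots> \<le> f xstar - (1 / L) * (g \<bullet> g) + L / 2 * (norm ((1 / L) *\<^sub>R g))\<^sup>2"
    using L_smooth_upper_bound[OF assms(1), of "xstar - (1 / L) *\<^sub>R g" xstar] by (simp add: g_def)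
  also have "\<dots> = f xstar - 1 / (2 * L) * (g \<bullet> g)"
    using assms(2) by (simp add: power_divide dot_square_norm field_simps power2_eq_square)
  finally have "g \<bullet> g \<le> 0"
    using assms(2) by (simp add: zero_le_divide_iff mult_le_0_iff divide_le_0_iff)
  then show ?thesis by (metis g_def inner_eq_zero_iff inner_ge_zero antisym)
qed

section \<open>The Lyapunov function and its one-step estimates\<close>

lemma norm_add_power2_le:
  fixes a b :: "'a::real_inner"
  shows "(norm (a + b))\<^sup>2 \<le> 2 * (norm a)\<^sup>2 + 2 * (norm b)\<^sup>2"
proof -
  have "0 \<le> (norm (a - b))\<^sup>2" by simp
  then show ?thesis
    unfolding dot_square_norm[symmetric]
    by (simp add: inner_diff_left inner_diff_right inner_add_left inner_add_right inner_commute)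
qed

text \<open>Weighted Cauchy-Schwarz, with 1/3 + 1/2 + 1/6 = 1. The sum of squares in the proof is
  twice the gap between the two sides. The weight 3 on the first vector is what makes the budget of
  \<open>h'\<close> in \<open>lyapunov_bound\<close> close exactly.\<close>

lemma norm_add3_power2_le:
  fixes a b c :: "'a::real_inner"
  shows "(norm (a + b + c))\<^sup>2 \<le> 3 * (norm a)\<^sup>2 + 2 * (norm b)\<^sup>2 + 6 * (norm c)\<^sup>2"
proof -
  have "0 \<le> (norm (2 *\<^sub>R a - b - c))\<^sup>2 + (norm (b - 3 *\<^sub>R c))\<^sup>2"
    by simp
  then show ?thesis
    unfolding dot_square_norm[symmetric]
    by (simp add: inner_diff_left inner_diff_right inner_add_left inner_add_right inner_commute)
qed

text \<open>The arguments stand for the gap f(x) - f(xstar), the gradient, x - xstar and the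
  rescaled velocity. They are left free, so that the estimates below are pure inner-product algebra
  without f.\<close>

definition lyapunov :: "real \<Rightarrow> real \<Rightarrow> real \<Rightarrow> real \<Rightarrow> 'a::real_inner \<Rightarrow> 'a \<Rightarrow> 'a \<Rightarrow> real" where
  "lyapunov \<alpha> \<beta> \<theta> h g y u =
     (1 - \<theta>) * (\<alpha> * \<theta> + 2 * \<beta>) * (h - \<alpha> / 2 * (norm g)\<^sup>2)
     + (norm u)\<^sup>2 / 2 + (norm (\<theta> *\<^sub>R (y - \<alpha> *\<^sub>R g) - u))\<^sup>2 / 2"

text \<open>The premises on \<open>h\<close> and \<open>h'\<close> are cocoercivity from the new
  point towards the old one and towards the minimizer. The three terms added to the new value are
  the dissipation that pays for the contraction.\<close>

lemma lyapunov_decrease: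
  fixes g g' u u' y y' :: "'a::real_inner"
  assumes y': "y' = y - \<alpha> *\<^sub>R g - u" and u': "u' = (1 - \<theta>) *\<^sub>R u + \<beta> *\<^sub>R g'"
    and h: "h' + g' \<bullet> (y - y') + \<alpha> * (norm (g - g'))\<^sup>2 \<le> h"
    and h': "h' + \<alpha> * (norm g')\<^sup>2 \<le> g' \<bullet> y'"
    and \<beta>: "0 \<le> \<beta>" "\<beta> \<le> \<alpha>" and \<theta>: "0 \<le> \<theta>" "\<theta> \<le> 1 / 2"
  shows "lyapunov \<alpha> \<beta> \<theta> h' g' y' u' + \<theta> * (\<alpha> * \<theta> + \<beta>) * h'
      + (\<alpha> * \<theta> + \<beta>) * \<alpha> * (1 - \<theta>) / 2 * (norm g')\<^sup>2 + \<theta> * (1 - \<theta> / 2) * (norm u)\<^sup>2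
    \<le> lyapunov \<alpha> \<beta> \<theta> h g y u"
proof -
  define P where "P = \<alpha> * \<theta> + \<beta>"
  define A where "A = (1 - \<theta>) * (\<alpha> * \<theta> + 2 * \<beta>)"
  define G where "G = g' \<bullet> g'"
  have \<alpha>: "0 \<le> \<alpha>" using \<beta> by linarith
  have P0: "0 \<le> P" and A0: "0 \<le> A" and G0: "0 \<le> G"
    using \<alpha> \<beta> \<theta> by (auto simp: P_def A_def G_def)
  \<comment> \<open>Since y - \<alpha> g = y' + u, both sides equal \<theta> y' - (1 - \<theta>)
    u.\<close>
  have z: "\<theta> *\<^sub>R (y - \<alpha> *\<^sub>R g) - u = (\<theta> *\<^sub>R (y' - \<alpha> *\<^sub>R g') - u') + P *\<^sub>R g'"
    by (simp add: y' u' P_def algebra_simps)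
  have "(norm (\<theta> *\<^sub>R (y - \<alpha> *\<^sub>R g) - u))\<^sup>2 - (norm (\<theta> *\<^sub>R (y' - \<alpha> *\<^sub>R g') - u'))\<^sup>2
      = 2 * P * (g' \<bullet> (\<theta> *\<^sub>R (y' - \<alpha> *\<^sub>R g') - u')) + P\<^sup>2 * G"
    unfolding z dot_square_norm[symmetric] G_def
    by (simp add: inner_add_left inner_add_right inner_commute power2_eq_square)
  also have "g' \<bullet> (\<theta> *\<^sub>R (y' - \<alpha> *\<^sub>R g') - u') = \<theta> * (g' \<bullet> y') - P * G - (1 - \<theta>) * (g' \<bullet> u)"
    unfolding u' P_def G_def by (simp add: inner_diff_right inner_add_right algebra_simps)
  finally have dz: "(norm (\<theta> *\<^sub>R (y - \<alpha> *\<^sub>R g) - u))\<^sup>2 / 2 - (norm (\<theta> *\<^sub>R (y' - \<alpha> *\<^sub>R g') - u'))\<^sup>2 / 2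
      = \<theta> * P * (g' \<bullet> y') - P\<^sup>2 / 2 * G - (1 - \<theta>) * P * (g' \<bullet> u)"
    by (simp add: algebra_simps power2_eq_square)
  have du: "(norm u)\<^sup>2 / 2 - (norm u')\<^sup>2 / 2
      = \<theta> * (1 - \<theta> / 2) * (norm u)\<^sup>2 - (1 - \<theta>) * \<beta> * (g' \<bullet> u) - \<beta>\<^sup>2 / 2 * G"
    unfolding u' dot_square_norm[symmetric] G_def
    by (simp add: inner_add_left inner_add_right inner_commute)
       (simp add: power2_eq_square field_simps)
  \<comment> \<open>One half of the cocoercivity term, once expanded, cancels \<alpha> <g', g> and
    \<alpha>/2 |g|^2 exactly, which is why the Lyapunov function carries the correction -\<alpha>/2
    |g|^2. The other half is discarded here.\<close>
  have "0 \<le> \<alpha> / 2 * (norm (g - g'))\<^sup>2" using \<alpha> by simp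
  then have "h' - \<alpha> / 2 * G + g' \<bullet> u + \<alpha> * G \<le> h - \<alpha> / 2 * (norm g)\<^sup>2"
    using h unfolding y' dot_square_norm[symmetric] G_def
    by (simp add: inner_simps inner_commute field_simps)
  then have "A * (h' - \<alpha> / 2 * G + g' \<bullet> u + \<alpha> * G) \<le> A * (h - \<alpha> / 2 * (norm g)\<^sup>2)"
    by (rule mult_left_mono) (rule A0)
  then have dh: "A * (h' - \<alpha> / 2 * G) + A * (g' \<bullet> u) + A * \<alpha> * G \<le> A * (h - \<alpha> / 2 * (norm g)\<^sup>2)"
    by (simp add: algebra_simps)
  have "\<theta> * P * (h' + \<alpha> * G) \<le> \<theta> * P * (g' \<bullet> y')"
    using h' P0 \<theta> by (intro mult_left_mono) (auto simp: G_def dot_square_norm)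
  then have dc: "\<theta> * P * h' + \<theta> * P * \<alpha> * G \<le> \<theta> * P * (g' \<bullet> y')"
    by (simp add: algebra_simps)
  have cross: "A * (g' \<bullet> u) = (1 - \<theta>) * P * (g' \<bullet> u) + (1 - \<theta>) * \<beta> * (g' \<bullet> u)"
    by (simp add: A_def P_def algebra_simps)
  \<comment> \<open>Balance of the coefficients of |g'|^2: gains from \<open>dc\<close> and
    \<open>dh\<close>, losses from \<open>dz\<close> and \<open>du\<close>. The slack splits into
    three products that are nonnegative by \<beta> \<le> \<alpha> and \<theta> \<le> 1/2.\<close>
  have "P * \<alpha> * (1 - \<theta>) / 2 \<le> \<theta> * P * \<alpha> + A * \<alpha> - P\<^sup>2 / 2 - \<beta>\<^sup>2 / 2"
  proof -
    have "0 \<le> P * (\<alpha> - \<beta>)" "0 \<le> \<beta> * (\<alpha> - \<beta>)" "0 \<le> \<alpha> * \<beta> * (1 - 2 * \<theta>)"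
      using \<alpha> \<beta> \<theta> P0 by auto
    then have "0 \<le> P * (\<alpha> - \<beta>) / 2 + \<beta> * (\<alpha> - \<beta>) / 2 + \<alpha> * \<beta> * (1 - 2 * \<theta>) / 2" by simp
    also have "\<dots> = \<theta> * P * \<alpha> + A * \<alpha> - P\<^sup>2 / 2 - \<beta>\<^sup>2 / 2 - P * \<alpha> * (1 - \<theta>) / 2"
      by (simp add: A_def P_def power2_eq_square field_simps)
    finally show ?thesis by simp
  qed
  then have "P * \<alpha> * (1 - \<theta>) / 2 * G \<le> (\<theta> * P * \<alpha> + A * \<alpha> - P\<^sup>2 / 2 - \<beta>\<^sup>2 / 2) * G"
    by (rule mult_right_mono) (rule G0)
  then have dG: "P * \<alpha> * (1 - \<theta>) / 2 * G
      \<le> \<theta> * P * \<alpha> * G + A * \<alpha> * G - P\<^sup>2 / 2 * G - \<beta>\<^sup>2 / 2 * G"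
    by (simp only: left_diff_distrib distrib_right)
  show ?thesis
    unfolding lyapunov_def A_def[symmetric] P_def[symmetric]
      dot_square_norm[of g', symmetric] G_def[symmetric]
    using dz du dh dc cross dG by linarith
qed

text \<open>The right-hand side is the dissipation of \<open>lyapunov_decrease\<close>. Each piece
  of the new Lyapunov value is charged to one of its terms: of the \<open>h'\<close> term, 2/5 pays
  for the potential and 3/5 for |y'|^2. This is where the factor 1/5 in the rate comes from.\<close>

lemma lyapunov_bound:
  fixes g' u u' y' :: "'a::real_inner"
  assumes u': "u' = (1 - \<theta>) *\<^sub>R u + \<beta> *\<^sub>R g'"
    and h': "0 \<le> h'" "\<mu> / 2 * (norm y')\<^sup>2 \<le> h'"
    and \<beta>: "0 \<le> \<beta>" "\<beta> \<le> \<alpha>" and \<theta>: "0 \<le> \<theta>" "\<theta> \<le> 1 / 2"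
    and r: "0 \<le> r" "r \<le> \<theta> / 5" "r * \<theta> \<le> \<beta> * \<mu> / 5"
  shows "r * lyapunov \<alpha> \<beta> \<theta> h' g' y' u' \<le> \<theta> * (\<alpha> * \<theta> + \<beta>) * h'
      + (\<alpha> * \<theta> + \<beta>) * \<alpha> * (1 - \<theta>) / 2 * (norm g')\<^sup>2 + \<theta> * (1 - \<theta> / 2) * (norm u)\<^sup>2"
proof -
  define P where "P = \<alpha> * \<theta> + \<beta>"
  define A where "A = (1 - \<theta>) * (\<alpha> * \<theta> + 2 * \<beta>)"
  define G where "G = (norm g')\<^sup>2"
  define W where "W = (norm u)\<^sup>2"
  define Y where "Y = (norm y')\<^sup>2"
  have \<alpha>: "0 \<le> \<alpha>" using \<beta> by linarith
  have nonneg: "0 \<le> P" "0 \<le> A" "0 \<le> G" "0 \<le> W" "0 \<le> Y"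
    using \<alpha> \<beta> \<theta> by (auto simp: P_def A_def G_def W_def Y_def)
  have \<beta>P: "\<beta> \<le> P" using \<alpha> \<theta> by (simp add: P_def)
  have "\<alpha> * \<theta> \<le> \<alpha> * (1 / 2)" by (rule mult_left_mono) (use \<alpha> \<theta> in auto)
  then have P\<alpha>: "P \<le> 3 / 2 * \<alpha>" using \<beta> by (simp add: P_def)

  \<comment> \<open>The new velocity is eliminated because the dissipation controls only the old
    one, \<open>u\<close>.\<close>
  have "\<theta> *\<^sub>R (y' - \<alpha> *\<^sub>R g') - u' = \<theta> *\<^sub>R y' + (- P) *\<^sub>R g' + (- (1 - \<theta>)) *\<^sub>R u"
    by (simp add: u' P_def algebra_simps)
  then have "(norm (\<theta> *\<^sub>R (y' - \<alpha> *\<^sub>R g') - u'))\<^sup>2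
      \<le> 3 * (norm (\<theta> *\<^sub>R y'))\<^sup>2 + 2 * (norm ((- P) *\<^sub>R g'))\<^sup>2 + 6 * (norm ((- (1 - \<theta>)) *\<^sub>R u))\<^sup>2"
    by (metis norm_add3_power2_le)
  also have "\<dots> = 3 * \<theta>\<^sup>2 * Y + 2 * P\<^sup>2 * G + 6 * (1 - \<theta>)\<^sup>2 * W"
    by (simp only: norm_scaleR power_mult_distrib power2_abs power2_minus G_def W_def Y_def
        mult.assoc)
  finally have z: "(norm (\<theta> *\<^sub>R (y' - \<alpha> *\<^sub>R g') - u'))\<^sup>2
      \<le> 3 * \<theta>\<^sup>2 * Y + 2 * P\<^sup>2 * G + 6 * (1 - \<theta>)\<^sup>2 * W" .

  have "(norm u')\<^sup>2 \<le> 2 * (norm ((1 - \<theta>) *\<^sub>R u))\<^sup>2 + 2 * (norm (\<beta> *\<^sub>R g'))\<^sup>2"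
    unfolding u' by (rule norm_add_power2_le)
  also have "\<dots> = 2 * (1 - \<theta>)\<^sup>2 * W + 2 * \<beta>\<^sup>2 * G"
    by (simp only: norm_scaleR power_mult_distrib power2_abs G_def W_def mult.assoc)
  finally have u: "(norm u')\<^sup>2 \<le> 2 * (1 - \<theta>)\<^sup>2 * W + 2 * \<beta>\<^sup>2 * G" .

  have "A * (h' - \<alpha> / 2 * G) \<le> A * h'"
    using nonneg \<alpha> by (intro mult_left_mono) auto
  then have "lyapunov \<alpha> \<beta> \<theta> h' g' y' u' \<le> A * h' + 3 / 2 * (\<theta>\<^sup>2 * Y)
      + (P\<^sup>2 + \<beta>\<^sup>2) * G + 4 * (1 - \<theta>)\<^sup>2 * W"
    unfolding lyapunov_def A_def[symmetric] G_def[symmetric]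
    using z u by (simp add: distrib_right)
  from mult_left_mono[OF this r(1)]
  have "r * lyapunov \<alpha> \<beta> \<theta> h' g' y' u' \<le> r * (A * h') + 3 / 2 * (r * \<theta> * \<theta> * Y)
      + r * ((P\<^sup>2 + \<beta>\<^sup>2) * G) + r * (4 * (1 - \<theta>)\<^sup>2 * W)"
    by (simp add: algebra_simps power2_eq_square)
  moreover have "r * (A * h') \<le> 2 / 5 * (\<theta> * P * h')"
  proof -
    have "r * A \<le> \<theta> / 5 * (2 * P)"
    proof (rule mult_mono)
      have "A \<le> 1 * (P + \<beta>)"
        unfolding A_def P_def using \<alpha> \<beta> \<theta> by (intro mult_mono) auto
      then show "A \<le> 2 * P" using \<beta>P by simp
    qed (use r \<theta> nonneg in auto)
    from mult_right_mono[OF this h'(1)] show ?thesis by (simp add: mult.assoc)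
  qed
  \<comment> \<open>Strong convexity enters here: r \<theta> \<le> \<beta> \<mu>/5 turns |y'|^2 into
    a multiple of \<open>h'\<close>, and \<beta> \<le> P completes the estimate.\<close>
  moreover have "3 / 2 * (r * \<theta> * \<theta> * Y) \<le> 3 / 5 * (\<theta> * P * h')"
  proof -
    have "(r * \<theta>) * (\<theta> * Y) \<le> (\<beta> * \<mu> / 5) * (\<theta> * Y)"
      using r \<theta> nonneg by (intro mult_right_mono) auto
    also have "\<dots> = 2 / 5 * (\<beta> * \<theta>) * (\<mu> / 2 * Y)" by simp
    also have "\<dots> \<le> 2 / 5 * (P * \<theta>) * h'"
      using h' \<beta> \<theta> \<beta>P nonneg
      by (intro order_trans[OF mult_left_mono mult_right_mono]) (auto simp: Y_def intro: mult_right_mono)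
    finally show ?thesis by (simp add: mult_ac)
  qed
  \<comment> \<open>From r \<le> \<theta>/5 \<le> 1/10 and P^2 + \<beta>^2 \<le> 5/2 P \<alpha> the
    factor is 1/4, which is at most (1 - \<theta>)/2.\<close>
  moreover have "r * ((P\<^sup>2 + \<beta>\<^sup>2) * G) \<le> P * \<alpha> * (1 - \<theta>) / 2 * G"
  proof -
    have "P * P \<le> P * (3 / 2 * \<alpha>)" "\<beta> * \<beta> \<le> P * \<alpha>"
      using P\<alpha> \<beta>P \<beta> \<alpha> nonneg by (auto intro!: mult_left_mono mult_mono simp del: times_divide_eq_left)
    then have "P\<^sup>2 + \<beta>\<^sup>2 \<le> 5 / 2 * (P * \<alpha>)" by (simp add: power2_eq_square)
    then have "r * (P\<^sup>2 + \<beta>\<^sup>2) \<le> 1 / 10 * (5 / 2 * (P * \<alpha>))"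
      using r \<theta> by (intro mult_mono) auto
    also have "\<dots> = P * \<alpha> * (1 / 4)" by simp
    also have "\<dots> \<le> P * \<alpha> * ((1 - \<theta>) / 2)"
      using \<theta> nonneg \<alpha> by (intro mult_left_mono) auto
    finally show ?thesis
      using nonneg mult_right_mono[of "r * (P\<^sup>2 + \<beta>\<^sup>2)" "P * \<alpha> * ((1 - \<theta>) / 2)" G]
      by (simp add: mult.assoc)
  qed
  moreover have "r * (4 * (1 - \<theta>)\<^sup>2 * W) \<le> \<theta> * (1 - \<theta> / 2) * W"
  proof -
    have "(1 - \<theta>)\<^sup>2 \<le> 1 - \<theta>"
      using \<theta> by (simp add: power2_eq_square mult_left_le)
    \<comment> \<open>The second factor uses 4 (1 - \<theta>) \<le> 5 (1 - \<theta>/2).\<close>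
    then have "r * (4 * (1 - \<theta>)\<^sup>2) \<le> \<theta> / 5 * (5 * (1 - \<theta> / 2))"
      using r \<theta> by (intro mult_mono) auto
    also have "\<dots> = \<theta> * (1 - \<theta> / 2)" by simp
    finally show ?thesis
      using mult_right_mono[OF _ nonneg(4)] by (simp only: mult.assoc[symmetric])
  qed
  ultimately show ?thesis
    unfolding P_def[symmetric] G_def[symmetric] W_def[symmetric] by linarith
qed

section \<open>From one-step contraction to the rate of the scheme\<close>

theorem theorem3:
  fixes f :: "real ^ 'd \<Rightarrow> real"
    and L \<mu> s m n q :: real
    and xstar :: "real ^ 'd"
    and x v :: "nat \<Rightarrow> real ^ 'd"
  assumes "L_smooth L f"
    and "\<mu> > 0"
    and "strongly_convex \<mu> f"
    and "is_arg_min f (\<lambda>_. True) xstar"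
    and "s > 0"
    and "0 < m * sqrt s" and "m * sqrt s \<le> 1 / (2 * L)"
    and "0 < n * s" and "n * s \<le> m * sqrt s"
    and "0 < q * sqrt s" and "q * sqrt s \<le> 1 / 2"
    and "semi_implicit_euler f m n q s x v"
  shows "\<exists>C>0. \<forall>k. f (x k) - f xstar \<le> (1 + gamma2 n q \<mu> L * sqrt s) powi (- int k) * C"
proof -
  define \<alpha> \<beta> \<theta> where "\<alpha> = m * sqrt s" and "\<beta> = n * s" and "\<theta> = q * sqrt s"
  define u where "u k = (n * sqrt s) *\<^sub>R v k" for k
  define g where "g k = gradient f (x k)" for k
  define y where "y k = x k - xstar" for k
  define h where "h k = f (x k) - f xstar" for k
  define r where "r = gamma2 n q \<mu> L * sqrt s"
  define A where "A = (1 - \<theta>) * (\<alpha> * \<theta> + 2 * \<beta>)"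
  define V where "V k = lyapunov \<alpha> \<beta> \<theta> (h k) (g k) (y k) (u k)" for k

  have pos: "0 < sqrt s" "0 < n" "0 < q" "0 < \<alpha>" "0 < \<beta>" "0 < \<theta>"
    using assms(5,6,8,10) by (auto simp: \<alpha>_def \<beta>_def \<theta>_def zero_less_mult_iff)
  \<comment> \<open>Positivity of L is extracted from the step bound; L = 0 is excluded as well,
    since division by zero yields 0.\<close>
  have "0 < 1 / (2 * L)" using assms(6,7) by linarith
  then have L: "0 < L" by simp
  have \<alpha>L: "\<alpha> \<le> 1 / (2 * L)" and \<beta>\<alpha>: "\<beta> \<le> \<alpha>" and \<theta>: "\<theta> \<le> 1 / 2"
    using assms(7,9,11) by (auto simp: \<alpha>_def \<beta>_def \<theta>_def)
  have A: "0 < A" using pos \<theta> by (simp add: A_def add_pos_pos)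
  have ss: "sqrt s * sqrt s = s" using assms(5) by simp

  \<comment> \<open>The step bound \<alpha> \<le> 1/(2 L) lets the cocoercivity constant be replaced
    by \<alpha>, the weight that the Lyapunov estimates expect.\<close>
  have coco: "f b + gradient f b \<bullet> (a - b) + \<alpha> * (norm (gradient f a - gradient f b))\<^sup>2 \<le> f a" for a b
  proof -
    have "\<alpha> * (norm (gradient f a - gradient f b))\<^sup>2
        \<le> 1 / (2 * L) * (norm (gradient f a - gradient f b))\<^sup>2"
      using \<alpha>L by (rule mult_right_mono) simp
    then show ?thesis
      using smooth_convex_lower_bound[OF assms(1) L, where x = a and y = b]
        strongly_convex_imp_first_order[OF assms(3)] assms(2) by fastforce
  qed
  have grad0: "gradient f xstar = 0" by (rule gradient_arg_min[OF assms(1) L assms(4)])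

  have step: "y (Suc k) = y k - \<alpha> *\<^sub>R g k - u k" "u (Suc k) = (1 - \<theta>) *\<^sub>R u k + \<beta> *\<^sub>R g (Suc k)" for k
  proof -
    have e: "x (Suc k) - x k = - (m * sqrt s) *\<^sub>R g k - (n * sqrt s) *\<^sub>R v k"
      "v (Suc k) - v k = sqrt s *\<^sub>R g (Suc k) - (q * sqrt s) *\<^sub>R v k"
      using assms(12) by (auto simp: semi_implicit_euler_def g_def)
    show "y (Suc k) = y k - \<alpha> *\<^sub>R g k - u k"
      using e(1) by (simp add: y_def \<alpha>_def u_def algebra_simps)
    have "v (Suc k) = (1 - \<theta>) *\<^sub>R v k + sqrt s *\<^sub>R g (Suc k)"
      using e(2) by (simp add: \<theta>_def algebra_simps)
    then show "u (Suc k) = (1 - \<theta>) *\<^sub>R u k + \<beta> *\<^sub>R g (Suc k)"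
      using ss by (simp add: u_def \<beta>_def scaleR_add_right mult.assoc)
  qed
  \<comment> \<open>The next three facts are \<open>coco\<close> with base point \<open>b\<close> at
    the new iterate, at the current iterate and at \<open>xstar\<close>. In \<open>of\<close> the
    base point comes first, because \<open>b\<close> occurs first in the statement.\<close>
  have h_step: "h (Suc k) + g (Suc k) \<bullet> (y k - y (Suc k)) + \<alpha> * (norm (g k - g (Suc k)))\<^sup>2 \<le> h k" for k
    using coco[of "x (Suc k)" "x k"] by (simp add: h_def g_def y_def)
  have h_inner: "h k + \<alpha> * (norm (g k))\<^sup>2 \<le> g k \<bullet> y k" for k
    using coco[of "x k" xstar] by (simp add: h_def g_def y_def grad0 inner_diff_right)
  have h_grad: "\<alpha> * (norm (g k))\<^sup>2 \<le> h k" for k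
    using coco[of xstar "x k"] by (simp add: h_def g_def grad0)
  have h_nonneg: "0 \<le> h k" for k
    using assms(4) by (simp add: h_def is_arg_min_linorder)
  have h_sc: "\<mu> / 2 * (norm (y k))\<^sup>2 \<le> h k" for k
  proof -
    have "f (x k) \<ge> f xstar + gradient f xstar \<bullet> (x k - xstar) + \<mu> / 2 * (norm (x k - xstar))\<^sup>2"
      using assms(3) unfolding strongly_convex_def by blast
    then show ?thesis by (simp add: grad0 h_def y_def)
  qed

  \<comment> \<open>The second entry of the minimum is at most q, its denominator being at least 1;
    the first entry, multiplied by q s, gives n s \<mu> = \<beta> \<mu>.\<close>
  have r: "0 \<le> r" "r \<le> \<theta> / 5" "r * \<theta> \<le> \<beta> * \<mu> / 5"
  proof -
    have d: "1 \<le> 1 + q\<^sup>2 / (n * L)" using pos L by simp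
    have g0: "0 \<le> gamma2 n q \<mu> L"
      using pos L assms(2) d by (simp add: gamma2_def)
    then show "0 \<le> r" using pos by (simp add: r_def)
    have "q / (1 + q\<^sup>2 / (n * L)) \<le> q / 1"
      using d pos by (intro divide_left_mono) auto
    then have "gamma2 n q \<mu> L \<le> q / 5" by (auto simp: gamma2_def min_def)
    from mult_right_mono[OF this, of "sqrt s"] pos
    show "r \<le> \<theta> / 5" by (simp add: r_def \<theta>_def)
    have "gamma2 n q \<mu> L \<le> n * \<mu> / q / 5" by (auto simp: gamma2_def min_def)
    then have "gamma2 n q \<mu> L * (q * s) \<le> n * \<mu> / q / 5 * (q * s)"
      using pos assms(5) by (intro mult_right_mono) auto
    also have "\<dots> = \<beta> * \<mu> / 5" using pos by (simp add: \<beta>_def)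
    also have "gamma2 n q \<mu> L * (q * s) = gamma2 n q \<mu> L * (q * (sqrt s * sqrt s))"
      by (simp only: ss)
    also have "\<dots> = r * \<theta>"
      by (simp only: r_def \<theta>_def mult_ac)
    finally show "r * \<theta> \<le> \<beta> * \<mu> / 5" .
  qed

  have contract: "(1 + r) * V (Suc k) \<le> V k" for k
  proof -
    have "r * V (Suc k) \<le> \<theta> * (\<alpha> * \<theta> + \<beta>) * h (Suc k)
        + (\<alpha> * \<theta> + \<beta>) * \<alpha> * (1 - \<theta>) / 2 * (norm (g (Suc k)))\<^sup>2 + \<theta> * (1 - \<theta> / 2) * (norm (u k))\<^sup>2"
      unfolding V_def using pos \<beta>\<alpha> \<theta>
      by (intro lyapunov_bound[OF step(2) h_nonneg h_sc _ _ _ _ r]) auto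
    moreover have "V (Suc k) + \<theta> * (\<alpha> * \<theta> + \<beta>) * h (Suc k)
        + (\<alpha> * \<theta> + \<beta>) * \<alpha> * (1 - \<theta>) / 2 * (norm (g (Suc k)))\<^sup>2 + \<theta> * (1 - \<theta> / 2) * (norm (u k))\<^sup>2 \<le> V k"
      unfolding V_def using pos \<beta>\<alpha> \<theta>
      by (intro lyapunov_decrease[OF step h_step h_inner]) auto
    ultimately show ?thesis by (simp add: distrib_right)
  qed
  have decay: "(1 + r) ^ k * V k \<le> V 0" for k
  proof (induction k)
    case (Suc k)
    have "(1 + r) ^ Suc k * V (Suc k) = (1 + r) ^ k * ((1 + r) * V (Suc k))" by simp
    also have "\<dots> \<le> (1 + r) ^ k * V k"
      using contract r(1) by (intro mult_left_mono) auto
    finally show ?case using Suc.IH by linarith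
  qed simp
  \<comment> \<open>By \<open>h_grad\<close> the correction \<alpha>/2 |g|^2 consumes at most half
    of the gap; the two squares are dropped.\<close>
  have lower: "A / 2 * h k \<le> V k" for k
  proof -
    have "A * (h k / 2) \<le> A * (h k - \<alpha> / 2 * (norm (g k))\<^sup>2)"
      using h_grad[of k] A by (intro mult_left_mono) auto
    then show ?thesis
      unfolding V_def lyapunov_def A_def[symmetric] by (simp add: add_nonneg_nonneg add_increasing2)
  qed
  show ?thesis
  proof (intro exI conjI allI)
    have "0 \<le> A / 2 * h 0" using A h_nonneg[of 0] by simp
    then have "0 \<le> V 0" using lower[of 0] by linarith
    \<comment> \<open>The summand 1 keeps the constant strictly positive even when
      \<open>V 0\<close> vanishes, as for a start at rest in the minimizer.\<close>
    then show "0 < 2 * V 0 / A + 1" using A by (simp add: add_nonneg_pos)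
    fix k
    have rk: "0 < (1 + r) ^ k" using r(1) by simp
    have "(1 + r) ^ k * (A / 2 * h k) \<le> V 0"
      using mult_left_mono[OF lower[of k], of "(1 + r) ^ k"] rk decay[of k] by linarith
    then have "(1 + r) ^ k * h k \<le> 2 * V 0 / A" using A by (simp add: field_simps)
    then have "h k \<le> (2 * V 0 / A + 1) / (1 + r) ^ k"
      using rk by (simp add: pos_le_divide_eq mult.commute)
    then show "f (x k) - f xstar \<le> (1 + gamma2 n q \<mu> L * sqrt s) powi (- int k) * (2 * V 0 / A + 1)"
      unfolding h_def r_def by (simp add: power_int_minus divide_inverse mult.commute)
  qed
qed

end
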